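(* Let $k \ge 3$. Then the set of length-2 factors of the infinite word $\mathbf{W}^{(k)}$ equals $\mathcal{B}^{(k)}$: $\mathrm{Fac}_2(\mathbf{W}^{(k)})=\mathcal{B}^{(k)}$.
   Context: Words are over the alphabet $\mathbb{N}=\{0,1,2,\dots\}$; $(x.y)$ denotes the length-2 word with letters $x,y$; $\mathrm{Fac}_2(V)$ is the set of length-2 factors of $V$. For $n\in\mathbb{N}$ and a word $W=w_0\cdots w_{m-1}$, $n\oplus W=(w_0+n)\cdots(w_{m-1}+n)$. For $k\ge 2$, $\phi_k$ is the morphism of $\mathbb{N}^*$ defined for $i\in\mathbb{N}$, $0\le j\le k-1$ by $\phi_k(ki+j)=(ki)(ki+j+1)$ if $0\le j\le k-2$ and $\phi_k(ki+k-1)=ki+k$; $\mathbf{W}^{(k)}=\lim_n\phi_k^n(0)$ is its infinite fixed point starting with $0$. Define $\mathcal{B}_1^{(k)}=\{(ki)\oplus(a.k): i\in\mathbb{N}, a\ge1\}$, $\mathcal{B}_2^{(k)}=\{(ki)\oplus(0.b): i\in\mathbb{N}, 1\le b\le k-1\}$, $\mathcal{B}_3^{(k)}=\{(a.0): a\ge1\}$, $\mathcal{B}^{(k)}=\mathcal{B}_1^{(k)}\cup\mathcal{B}_2^{(k)}\cup\mathcal{B}_3^{(k)}$. *)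

theory Defs imports "HOL-Library.Sublist"
begin

text \<open>Finite words over the alphabet of natural numbers are lists; infinite words are
  functions from positions (starting at 0) to letters.\<close>

type_synonym word = "nat list"
type_synonym inf_word = "nat \<Rightarrow> nat"

definition shift :: "nat \<Rightarrow> word \<Rightarrow> word" where
  "shift n w = map (\<lambda>x. x + n) w"

definition Fac :: "nat \<Rightarrow> inf_word \<Rightarrow> word set" where
  "Fac m V = {map V [p..<p + m] | p. True}"

text \<open>A letter \<open>n\<close> is written \<open>k i + j\<close> with \<open>i = n div k\<close> and \<open>j = n mod k\<close>; see
  \<open>phi_letter_mult_add\<close> and \<open>phi_letter_mult_last\<close> below.\<close>

definition phi_letter :: "nat \<Rightarrow> nat \<Rightarrow> word" where
  "phi_letter k n =
    (let i = n div k; j = n mod k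
     in if j \<le> k - 2 then [k * i, k * i + j + 1] else [k * i + k])"

definition phi :: "nat \<Rightarrow> word \<Rightarrow> word" where
  "phi k w = concat (map (phi_letter k) w)"

text \<open>Every position of the limit word is eventually present and constant in the sequence.\<close>

definition word_limit :: "(nat \<Rightarrow> word) \<Rightarrow> inf_word \<Rightarrow> bool" where
  "word_limit u V \<longleftrightarrow> (\<forall>p. \<exists>N. \<forall>n\<ge>N. p < length (u n) \<and> u n ! p = V p)"

definition W :: "nat \<Rightarrow> inf_word" where
  "W k = (THE V. word_limit (\<lambda>n. (phi k ^^ n) [0]) V)"

definition B1 :: "nat \<Rightarrow> word set" where
  "B1 k = {shift (k * i) [a, k] | i a. 1 \<le> a}"

definition B2 :: "nat \<Rightarrow> word set" where
  "B2 k = {shift (k * i) [0, b] | i b. 1 \<le> b \<and> b \<le> k - 1}"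

definition B3 :: "word set" where
  "B3 = {[a, 0] | a. 1 \<le> a}"

definition B :: "nat \<Rightarrow> word set" where
  "B k = B1 k \<union> B2 k \<union> B3"

lemma phi_letter_mult_add:
  assumes "2 \<le> k" "j \<le> k - 2"
  shows "phi_letter k (k * i + j) = [k * i, k * i + j + 1]"
proof -
  have "j < k" using assms by linarith
  then show ?thesis using assms by (simp add: phi_letter_def Let_def)
qed

lemma phi_letter_mult_last:
  assumes "2 \<le> k"
  shows "phi_letter k (k * i + (k - 1)) = [k * i + k]"
proof -
  have "k - 1 < k" using assms by simp
  then have "(k * i + (k - 1)) div k = i" "(k * i + (k - 1)) mod k = k - 1"
    by (metis add.right_neutral div_less div_mult_self4 less_zeroE,
        metis mod_less mod_mult_self4)
  then show ?thesis using assms unfolding phi_letter_def Let_def by simp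
qed

lemma word_limit_unique:
  assumes "word_limit u V" "word_limit u V'"
  shows "V = V'"
proof
  fix p
  obtain N N' where "\<forall>n\<ge>N. u n ! p = V p" "\<forall>n\<ge>N'. u n ! p = V' p"
    using assms unfolding word_limit_def by metis
  then show "V p = V' p" by (metis max.cobounded1 max.cobounded2)
qed

text \<open>The limit defining \<open>W\<close> exists: the iterates are strictly increasing prefixes.\<close>

lemma phi_append: "phi k (u @ v) = phi k u @ phi k v"
  by (simp add: phi_def)

lemma phi_eq_Nil_iff: "phi k w = [] \<longleftrightarrow> w = []"
  by (cases w) (auto simp: phi_def phi_letter_def Let_def)

lemma phi_iterate_step: "2 \<le> k \<Longrightarrow> \<exists>v. v \<noteq> [] \<and> (phi k ^^ Suc n) [0] = (phi k ^^ n) [0] @ v"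
proof (induction n)
  case 0
  have "phi k [0] = [0, 1]" by (simp add: phi_def phi_letter_def)
  then show ?case by simp
next
  case (Suc n)
  then obtain v where v: "v \<noteq> []" "(phi k ^^ Suc n) [0] = (phi k ^^ n) [0] @ v"
    by blast
  have "(phi k ^^ Suc (Suc n)) [0] = phi k ((phi k ^^ n) [0] @ v)"
    using v(2) by simp
  then show ?case using v(1) by (auto simp: phi_append phi_eq_Nil_iff)
qed

lemma phi_iterate_length: "2 \<le> k \<Longrightarrow> n < length ((phi k ^^ n) [0])"
proof (induction n)
  case (Suc n)
  then obtain v where v: "v \<noteq> []" "(phi k ^^ Suc n) [0] = (phi k ^^ n) [0] @ v"
    using phi_iterate_step by blast
  then have "Suc n < length ((phi k ^^ n) [0]) + length v"
    using Suc by (cases v) auto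
  then show ?case using v(2) by (metis length_append)
qed simp

lemma phi_iterate_prefix:
  assumes "2 \<le> k" "m \<le> n"
  shows "prefix ((phi k ^^ m) [0]) ((phi k ^^ n) [0])"
  using assms(2)
proof (induction n rule: dec_induct)
  case (step n)
  have "prefix ((phi k ^^ n) [0]) ((phi k ^^ Suc n) [0])"
    using phi_iterate_step[OF assms(1), of n] by (metis prefixI)
  with step.IH show ?case by (rule prefix_order.trans)
qed simp

lemma word_limit_W:
  assumes "2 \<le> k"
  shows "word_limit (\<lambda>n. (phi k ^^ n) [0]) (W k)"
proof -
  let ?u = "\<lambda>n. (phi k ^^ n) [0]"
  have "p < length (?u n) \<and> ?u n ! p = ?u p ! p" if "p \<le> n" for p n
  proof -
    obtain v where v: "?u n = ?u p @ v"
      using phi_iterate_prefix[OF assms \<open>p \<le> n\<close>] by (meson prefixE)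
    show ?thesis using phi_iterate_length[OF assms, of p]
      unfolding v by (simp add: nth_append)
  qed
  then have "word_limit ?u (\<lambda>p. ?u p ! p)"
    unfolding word_limit_def by blast
  then show ?thesis unfolding W_def by (metis (mono_tags, lifting) theI word_limit_unique)
qed

end

theory Submission imports Defs
begin

text \<open>Two adjacent letters \<open>x y\<close> produce in the image under \<open>\<phi>\<^sub>k\<close> the boundary factor made of
  the last letter \<open>x + 1\<close> of \<open>\<phi>\<^sub>k(x)\<close> and the first letter \<open>k \<lfloor>(y + 1) / k\<rfloor>\<close> of \<open>\<phi>\<^sub>k(y)\<close>;
  all other length-2 factors of an image are words \<open>\<phi>\<^sub>k(x)\<close>, which lie in \<open>\<B>\<^sub>2\<close>.
  The set \<open>\<B>\<close> contains \<open>0 1\<close> and is closed under \<open>x y \<mapsto> (x + 1) (k \<lfloor>(y + 1) / k\<rfloor>)\<close>, so it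
  contains every factor. Conversely every letter occurs, hence so does all of \<open>\<B>\<^sub>2\<close>, and the
  same map sends \<open>(k i) (k i + k - 1)\<close> through all \<open>(k i + a) (k i + k)\<close>, and \<open>0 1\<close> through
  all \<open>a 0\<close>.\<close>

section \<open>The morphism on letters and factors of its iterates\<close>

text \<open>Working with \<open>Suc n\<close> absorbs the split into \<open>i\<close> and
  \<open>j\<close>: if the last base-\<open>k\<close> digit of \<open>n\<close> is
  \<open>k - 1\<close>, adding one carries and the image is a single multiple of \<open>k\<close>;
  otherwise the quotient by \<open>k\<close> is unchanged.\<close>

lemma phi_letter_eq:
  assumes "2 \<le> k"
  shows "phi_letter k n = (if k dvd Suc n then [Suc n] else [k * (Suc n div k), Suc n])"
proof -
  have n: "n = k * (n div k) + n mod k" by simp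
  show ?thesis
  proof (cases "n mod k \<le> k - 2")
    case True
    then have "Suc (n mod k) \<noteq> k" using assms by linarith
    then have "Suc n mod k \<noteq> 0" by (simp add: mod_Suc)
    then have "\<not> k dvd Suc n" "Suc n div k = n div k" by (auto simp: div_Suc)
    with True show ?thesis by (simp add: phi_letter_def Let_def)
  next
    case False
    moreover have "n mod k < k" using assms by simp
    ultimately have "n mod k = k - 1" by linarith
    then have "Suc n mod k = 0" "Suc n = k * (n div k) + k"
      using n assms by (simp_all add: mod_Suc)
    then show ?thesis using False by (auto simp: phi_letter_def Let_def)
  qed
qed

lemma phi_letter_neq_Nil: "phi_letter k n \<noteq> []"
  by (simp add: phi_letter_def Let_def)

lemma last_phi_letter: "2 \<le> k \<Longrightarrow> last (phi_letter k n) = Suc n"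
  by (simp add: phi_letter_eq)

lemma hd_phi_letter: "2 \<le> k \<Longrightarrow> hd (phi_letter k n) = k * (Suc n div k)"
  by (simp add: phi_letter_eq)

lemma phi_Cons: "phi k (x # w) = phi_letter k x @ phi k w"
  by (simp add: phi_def)

lemma sublist_phi: "sublist v w \<Longrightarrow> sublist (phi k v) (phi k w)"
  unfolding sublist_def by (metis phi_append)

lemma nth_phi_iterate:
  assumes "2 \<le> k" "p < length ((phi k ^^ n) [0])"
  shows "(phi k ^^ n) [0] ! p = W k p"
proof -
  obtain N where N: "\<And>m. N \<le> m \<Longrightarrow> (phi k ^^ m) [0] ! p = W k p"
    using word_limit_W[OF assms(1)] unfolding word_limit_def by blast
  \<comment> \<open>In iterate \<open>max n N\<close> the letter at \<open>p\<close> is inherited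
    from iterate \<open>n\<close> and already has its limit value.\<close>
  have "prefix ((phi k ^^ n) [0]) ((phi k ^^ max n N) [0])"
    using assms(1) by (intro phi_iterate_prefix) simp_all
  then have "(phi k ^^ max n N) [0] ! p = (phi k ^^ n) [0] ! p"
    using assms(2) by (auto simp: prefix_def nth_append)
  with N[of "max n N"] show ?thesis by simp
qed

text \<open>Moves factors into finite iterates, where \<open>phi\<close> acts as a morphism and
  induction on the iterate applies.\<close>

lemma Fac_W_iff:
  assumes "2 \<le> k"
  shows "w \<in> Fac m (W k) \<longleftrightarrow> length w = m \<and> (\<exists>n. sublist w ((phi k ^^ n) [0]))"
proof (intro iffI conjI; (elim conjE exE)?)
  assume "w \<in> Fac m (W k)"
  then obtain p where w: "w = map (W k) [p..<p + m]" unfolding Fac_def by blast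
  then show "length w = m" by simp
  let ?u = "(phi k ^^ (p + m)) [0]"
  have "p + m < length ?u" using assms by (rule phi_iterate_length)
  then have "w = take m (drop p ?u)"
    unfolding w by (intro nth_equalityI) (simp_all add: nth_phi_iterate[OF assms])
  moreover have "sublist (take m (drop p ?u)) ?u"
    using sublist_order.order.trans[OF sublist_take sublist_drop] .
  ultimately show "\<exists>n. sublist w ((phi k ^^ n) [0])" by blast
next
  fix n assume m: "length w = m" and "sublist w ((phi k ^^ n) [0])"
  then obtain a b where u: "(phi k ^^ n) [0] = a @ w @ b" by (auto simp: sublist_def)
  have "w = map (W k) [length a..<length a + m]"
  proof (intro nth_equalityI)
    fix i assume "i < length w"
    then show "w ! i = map (W k) [length a..<length a + m] ! i"
      using nth_phi_iterate[OF assms, of "length a + i" n] m by (simp add: u nth_append)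
  qed (simp add: m)
  then show "w \<in> Fac m (W k)" unfolding Fac_def by blast
qed

section \<open>Every factor lies in \<open>B k\<close>\<close>

lemma B1_I: "1 \<le> a \<Longrightarrow> [k * i + a, k * i + k] \<in> B k"
  unfolding B_def B1_def shift_def by (auto simp: add.commute)

lemma B2_I: "1 \<le> b \<Longrightarrow> b \<le> k - 1 \<Longrightarrow> [k * i, k * i + b] \<in> B k"
  unfolding B_def B2_def shift_def by (auto simp: add.commute)

lemma B3_I: "1 \<le> a \<Longrightarrow> [a, 0] \<in> B k"
  unfolding B_def B3_def by auto

lemma B_cases:
  assumes "[x, y] \<in> B k"
  obtains i a where "1 \<le> a" "x = k * i + a" "y = k * i + k"
  | i b where "1 \<le> b" "b \<le> k - 1" "x = k * i" "y = k * i + b"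
  | "1 \<le> x" "y = 0"
  using assms unfolding B_def B1_def B2_def B3_def shift_def
  by (auto simp: add.commute)

lemma B_boundary:
  assumes "2 \<le> k" "[x, y] \<in> B k"
  shows "[Suc x, k * (Suc y div k)] \<in> B k"
  using assms(2)
proof (cases rule: B_cases)
  case (1 i a)
  have "Suc y = k * Suc i + 1" using 1 by simp
  then have "Suc y div k = Suc i" using assms(1) by (simp only: div_mult_self4) simp
  then show ?thesis using B1_I[of "Suc a" k i] 1 by (simp add: add.commute)
next
  case (2 i b)
  show ?thesis
  proof (cases "b = k - 1")
    case True
    then have "Suc y = k * Suc i" using 2 assms(1) by simp
    then have "Suc y div k = Suc i" using assms(1) by (simp del: mult_Suc_right)
    then show ?thesis using B1_I[of 1 k i] 2 by (simp add: add.commute)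
  next
    case False
    then have "Suc b < k" using 2 by simp
    then have "(k * i + Suc b) div k = i" by (simp del: add_Suc_right)
    then have "Suc y div k = i" using 2 by simp
    \<comment> \<open>The pair is now \<open>[k * i + 1, k * i]\<close>: for \<open>i = 0\<close> it
      lies in \<open>B3\<close>, otherwise in \<open>B1 k\<close> with index \<open>i - 1\<close>
      and \<open>a = k + 1\<close>.\<close>
    then show ?thesis
      using B1_I[of "Suc k" k "i - 1"] B3_I[of 1 k] 2 by (cases i) (simp_all add: add.commute)
  qed
next
  case 3
  then show ?thesis using assms(1) B3_I[of "Suc x" k] by simp
qed

text \<open>An adjacent pair of \<open>phi k w\<close> either is a whole block
  \<open>phi_letter k x\<close>, hence in \<open>B2 k\<close> with the nonzero digit
  \<open>Suc x mod k\<close>, or straddles two blocks, where \<open>B_boundary\<close>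
  applies.\<close>

lemma successively_phi:
  assumes "2 \<le> k" "successively (\<lambda>x y. [x, y] \<in> B k) w"
  shows "successively (\<lambda>x y. [x, y] \<in> B k) (phi k w)"
  using assms(2)
proof (induction w)
  case (Cons x w)
  have "successively (\<lambda>x y. [x, y] \<in> B k) (phi_letter k x)"
  proof (cases "k dvd Suc x")
    case False
    let ?b = "Suc x mod k"
    have "1 \<le> ?b" using False by (simp add: dvd_eq_mod_eq_0)
    moreover have "?b \<le> k - 1" using assms(1) mod_less_divisor[of k "Suc x"] by linarith
    ultimately have "[k * (Suc x div k), Suc x] \<in> B k"
      using B2_I[of ?b k "Suc x div k"] by simp
    then show ?thesis using False assms(1) by (simp add: phi_letter_eq)
  qed (simp add: assms(1) phi_letter_eq)
  moreover have "[last (phi_letter k x), hd (phi k w)] \<in> B k" if "w \<noteq> []"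
  proof -
    from that obtain y v where w: "w = y # v" by (cases w) auto
    have "[x, y] \<in> B k" using Cons.prems w by simp
    then show ?thesis using B_boundary[OF assms(1)] assms(1)
      by (simp add: w phi_Cons phi_letter_neq_Nil last_phi_letter hd_phi_letter)
  qed
  ultimately show ?case using Cons
    by (auto simp: phi_Cons successively_append_iff successively_Cons phi_eq_Nil_iff)
qed (simp add: phi_def)

lemma successively_phi_iterate:
  assumes "2 \<le> k"
  shows "successively (\<lambda>x y. [x, y] \<in> B k) ((phi k ^^ n) [0])"
  using successively_phi[OF assms] by (induction n) simp_all

lemma Fac_2_W_subset:
  assumes "2 \<le> k"
  shows "Fac 2 (W k) \<subseteq> B k"
proof
  fix w assume "w \<in> Fac 2 (W k)"
  then obtain n where "length w = 2" "sublist w ((phi k ^^ n) [0])"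
    using Fac_W_iff[OF assms] by blast
  then obtain x y a b where "w = [x, y]" "(phi k ^^ n) [0] = a @ [x, y] @ b"
    by (auto simp: sublist_def numeral_2_eq_2 length_Suc_conv)
  then show "w \<in> B k"
    using successively_phi_iterate[OF assms, of n] by (simp add: successively_append_iff)
qed

section \<open>Every word of \<open>B k\<close> occurs\<close>

lemma Fac_W_phi:
  assumes "2 \<le> k" "v \<in> Fac m (W k)" "sublist w (phi k v)"
  shows "w \<in> Fac (length w) (W k)"
proof -
  obtain n where "sublist v ((phi k ^^ n) [0])" using assms Fac_W_iff by blast
  then have "sublist (phi k v) ((phi k ^^ Suc n) [0])"
    using sublist_phi by simp
  then have "sublist w ((phi k ^^ Suc n) [0])"
    by (rule sublist_order.order.trans[OF assms(3)])
  then show ?thesis using Fac_W_iff[OF assms(1)] by blast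
qed

text \<open>All letters are reached from 0, since the image of \<open>x\<close> ends in
  \<open>Suc x\<close>.\<close>

lemma letter_in_Fac_W:
  assumes "2 \<le> k"
  shows "[x] \<in> Fac 1 (W k)"
proof (induction x)
  case 0
  show ?case unfolding Fac_W_iff[OF assms] by (auto intro: exI[of _ 0])
next
  case (Suc x)
  have "sublist [Suc x] (phi k [x])"
    using assms by (simp add: phi_Cons phi_letter_eq phi_def sublist_Cons_right)
  from Fac_W_phi[OF assms Suc this] show ?case by simp
qed

lemma Fac_W_boundary:
  assumes "2 \<le> k" "[x, y] \<in> Fac 2 (W k)"
  shows "[Suc x, k * (Suc y div k)] \<in> Fac 2 (W k)"
proof -
  obtain p where "phi_letter k x = p @ [Suc x]"
    using append_butlast_last_id[OF phi_letter_neq_Nil[of k x]] last_phi_letter[OF assms(1), of x] by metis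
  moreover obtain s where "phi_letter k y = (k * (Suc y div k)) # s"
    using list.collapse[OF phi_letter_neq_Nil[of k y]] hd_phi_letter[OF assms(1), of y] by metis
  ultimately have "phi k [x, y] = p @ [Suc x, k * (Suc y div k)] @ s"
    by (simp add: phi_def)
  then have "sublist [Suc x, k * (Suc y div k)] (phi k [x, y])" by (auto simp: sublist_def)
  from Fac_W_phi[OF assms this] show ?thesis by (simp add: numeral_2_eq_2)
qed

lemma B2_in_Fac_W:
  assumes "2 \<le> k" "1 \<le> b" "b \<le> k - 1"
  shows "[k * i, k * i + b] \<in> Fac 2 (W k)"
proof -
  have "phi k [k * i + (b - 1)] = [k * i, k * i + b]"
    using assms phi_letter_mult_add[of k "b - 1" i] by (simp add: phi_def)
  then show ?thesis
    using Fac_W_phi[OF assms(1) letter_in_Fac_W[OF assms(1)],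
        of "[k * i, k * i + b]" "k * i + (b - 1)"]
    by (simp add: numeral_2_eq_2)
qed

text \<open>The start is the \<open>B2 k\<close> word with \<open>b = k - 1\<close>, the digit for
  which \<open>Suc y\<close> carries to \<open>k * Suc i\<close>. Afterwards the boundary map fixes
  the second letter \<open>k * i + k\<close> and raises the first by one.\<close>

lemma B1_in_Fac_W:
  assumes "2 \<le> k" "1 \<le> a"
  shows "[k * i + a, k * i + k] \<in> Fac 2 (W k)"
  using assms(2)
proof (induction a rule: dec_induct)
  case base
  have "[k * i, k * i + (k - 1)] \<in> Fac 2 (W k)" using assms(1) by (intro B2_in_Fac_W) simp_all
  from Fac_W_boundary[OF assms(1) this]
  have "[Suc (k * i), k * (Suc (k * i + (k - 1)) div k)] \<in> Fac 2 (W k)" .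
  moreover have "Suc (k * i + (k - 1)) = k * Suc i" using assms(1) by simp
  then have "k * (Suc (k * i + (k - 1)) div k) = k * i + k"
    by (metis add.commute dvd_mult_div_cancel dvd_triv_left mult_Suc_right)
  ultimately show ?case by simp
next
  case (step a)
  have "Suc (k * i + k) = k * Suc i + 1" by simp
  then have "Suc (k * i + k) div k = Suc i" using assms(1) by (simp only: div_mult_self4) simp
  then show ?case using Fac_W_boundary[OF assms(1) step.IH] by (simp add: add.commute)
qed

text \<open>Here \<open>k >= 3\<close> enters: \<open>2 div k = 0\<close>, so \<open>[0, 1]\<close>
  yields \<open>[1, 0]\<close>, whereas \<open>k = 2\<close> would yield \<open>[1, 2]\<close>. The
  final 0 then persists.\<close>

lemma B3_in_Fac_W:
  assumes "3 \<le> k" "1 \<le> a"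
  shows "[a, 0] \<in> Fac 2 (W k)"
  using assms(2)
proof (induction a rule: dec_induct)
  case base
  have "[0, 1] \<in> Fac 2 (W k)" using B2_in_Fac_W[of k 1 0] assms(1) by simp
  then show ?case using Fac_W_boundary[of k 0 1] assms(1) by simp
next
  case (step a)
  then show ?case using Fac_W_boundary[of k a 0] assms(1) by simp
qed

theorem theorem5p4:
  fixes k :: nat
  assumes "k \<ge> 3"
  shows "Fac 2 (W k) = B k"
proof
  show "Fac 2 (W k) \<subseteq> B k" using assms by (intro Fac_2_W_subset) simp
  show "B k \<subseteq> Fac 2 (W k)"
    using assms B1_in_Fac_W[of k] B2_in_Fac_W[of k] B3_in_Fac_W[of k]
    unfolding B_def B1_def B2_def B3_def shift_def by (auto simp: add.commute)
qed

end
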